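(* Let $N,K$ be positive integers with $\left\lceil\frac{K+1}{2}\right\rceil\le N\le K$. For the $(N,K)$ cache network, every achievable memory-rate pair $(M,R)$ satisfies $$KM+K(N-1)R\ \ge\ KN-1.$$
   Context: The $(N,K)$ cache network ($1\le N\le K$): a server holds $N$ files and is connected by an error-free broadcast link to $K$ users $U_1,\dots,U_K$, each with its own cache. Write $[L]=\{1,\dots,L\}$. Scheme. Fix real numbers $M\in[0,N]$, $R\ge 0$. A caching scheme with cache size $M$ and rate $R$ consists of a positive integer $F$ (file size in bits) and the following. The files $W_1,\dots,W_N$ are independent and uniformly distributed on $\{0,1\}^F$. For each $k\in[K]$ the cache content $Z_k$ of user $U_k$ is a deterministic function of $(W_1,\dots,W_N)$ consisting of at most $MF$ bits. A demand is $\mathbf d=(d(1),\dots,d(K))\in[N]^K$, meaning that $U_k$ requests $W_{d(k)}$. $\mathbf D$ is the set of demands in which each of the $N$ files is requested by at least one user. For each $\mathbf d\in\mathbf D$ the broadcast $X_{\mathbf d}$ is a deterministic function of $(W_1,\dots,W_N)$ consisting of at most $RF$ bits, such that for every $k\in[K]$ the file $W_{d(k)}$ is determined by $(Z_k,X_{\mathbf d})$. (The caches do not depend on the demand.) Entropy $H$ is Shannon entropy in bits divided by $F$, so $H(W_n)=1$. Symmetric scheme. A scheme is symmetric if for all permutations $\pi$ of $[K]$ and $\sigma$ of $[N]$ and all $A\subseteq[N]$, $B\subseteq[K]$, $E\subseteq\mathbf D$, $$H\big((W_n)_{n\in A},(Z_k)_{k\in B},(X_{\mathbf d})_{\mathbf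 d\in E}\big)=H\big((W_{\sigma(n)})_{n\in A},(Z_{\pi(k)})_{k\in B},(X_{\sigma\circ\mathbf d\circ\pi^{-1}})_{\mathbf d\in E}\big).$$ Throughout, only symmetric schemes are considered: a pair $(M,R)$ is achievable if there is (for some $F$) a symmetric scheme with cache size $M$ and rate $R$. *)

theory Defs
  imports "HOL-Probability.Information" "HOL-Combinatorics.Permutations"
begin

text \<open>
  Users are indexed by \<open>{1..K}\<close> and files by \<open>{1..N}\<close>; bit strings are boolean lists.  A tuple of
  files is an extensional function \<open>w\<close> on \<open>{1..N}\<close>, so the random variable \<open>W\<^sub>n\<close> is
  \<open>\<lambda>w. w n\<close> and every random variable of a scheme is a function of \<open>w\<close>.
\<close>

definition file_measure :: "nat \<Rightarrow> nat \<Rightarrow> (nat \<Rightarrow> bool list) measure" where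
  "file_measure N F = (\<Pi>\<^sub>M n\<in>{1..N}. uniform_count_measure {s :: bool list. length s = F})"

definition demands :: "nat \<Rightarrow> nat \<Rightarrow> (nat \<Rightarrow> nat) set" where
  "demands N K = {d \<in> {1..K} \<rightarrow>\<^sub>E {1..N}. d ` {1..K} = {1..N}}"

text \<open>
  ``At most \<open>m\<close> bits'' means a string of some fixed length not exceeding \<open>m\<close>.  A length varying
  with \<open>w\<close> is not allowed, since it would itself carry information.
\<close>

definition at_most_bits :: "'a set \<Rightarrow> ('a \<Rightarrow> bool list) \<Rightarrow> real \<Rightarrow> bool" where
  "at_most_bits S Y m \<longleftrightarrow> (\<exists>l::nat. real l \<le> m \<and> (\<forall>w\<in>S. length (Y w) = l))"

definition caching_scheme ::
  "nat \<Rightarrow> nat \<Rightarrow> real \<Rightarrow> real \<Rightarrow> nat \<Rightarrow> (nat \<Rightarrow> (nat \<Rightarrow> bool list) \<Rightarrow> bool list)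
    \<Rightarrow> ((nat \<Rightarrow> nat) \<Rightarrow> (nat \<Rightarrow> bool list) \<Rightarrow> bool list) \<Rightarrow> bool" where
  "caching_scheme N K M R F Z X \<longleftrightarrow>
     0 < F \<and>
     (\<forall>k\<in>{1..K}. at_most_bits (space (file_measure N F)) (Z k) (M * real F)) \<and>
     (\<forall>d\<in>demands N K. at_most_bits (space (file_measure N F)) (X d) (R * real F)) \<and>
     (\<forall>d\<in>demands N K. \<forall>k\<in>{1..K}.
        \<exists>dec :: bool list \<Rightarrow> bool list \<Rightarrow> bool list.
          \<forall>w\<in>space (file_measure N F). w (d k) = dec (Z k w) (X d w))"

definition normalized_entropy :: "nat \<Rightarrow> nat \<Rightarrow> ((nat \<Rightarrow> bool list) \<Rightarrow> 'b) \<Rightarrow> real" where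
  "normalized_entropy N F Y =
     prob_space.entropy (file_measure N F) 2 (count_space (Y ` space (file_measure N F))) Y / real F"

text \<open>
  The demand \<open>\<sigma> \<circ> d \<circ> \<pi>\<^sup>-\<^sup>1\<close> has to be restricted again to \<open>{1..K}\<close>, since \<open>\<sigma>\<close> may
  move the value \<open>undefined\<close> that \<open>d\<close> takes outside \<open>{1..K}\<close>.
\<close>

definition permute_demand ::
  "nat \<Rightarrow> (nat \<Rightarrow> nat) \<Rightarrow> (nat \<Rightarrow> nat) \<Rightarrow> (nat \<Rightarrow> nat) \<Rightarrow> nat \<Rightarrow> nat" where
  "permute_demand K \<pi> \<sigma> d = restrict (\<sigma> \<circ> d \<circ> inv \<pi>) {1..K}"

definition symmetric_scheme ::
  "nat \<Rightarrow> nat \<Rightarrow> nat \<Rightarrow> (nat \<Rightarrow> (nat \<Rightarrow> bool list) \<Rightarrow> bool list)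
    \<Rightarrow> ((nat \<Rightarrow> nat) \<Rightarrow> (nat \<Rightarrow> bool list) \<Rightarrow> bool list) \<Rightarrow> bool" where
  "symmetric_scheme N K F Z X \<longleftrightarrow>
     (\<forall>\<pi> \<sigma> A B E. \<pi> permutes {1..K} \<longrightarrow> \<sigma> permutes {1..N} \<longrightarrow>
        A \<subseteq> {1..N} \<longrightarrow> B \<subseteq> {1..K} \<longrightarrow> E \<subseteq> demands N K \<longrightarrow>
        normalized_entropy N F
          (\<lambda>w. (\<lambda>n\<in>A. w n, \<lambda>k\<in>B. Z k w, \<lambda>d\<in>E. X d w)) =
        normalized_entropy N F
          (\<lambda>w. (\<lambda>n\<in>A. w (\<sigma> n), \<lambda>k\<in>B. Z (\<pi> k) w, \<lambda>d\<in>E. X (permute_demand K \<pi> \<sigma> d) w)))"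

definition achievable :: "nat \<Rightarrow> nat \<Rightarrow> real \<Rightarrow> real \<Rightarrow> bool" where
  "achievable N K M R \<longleftrightarrow>
     0 \<le> M \<and> M \<le> real N \<and> 0 \<le> R \<and>
     (\<exists>F Z X. caching_scheme N K M R F Z X \<and> symmetric_scheme N K F Z X)"

lemma finite_bit_strings: "finite {s :: bool list. length s = F}"
  using finite_lists_length_eq[of "UNIV :: bool set" F] by simp

lemma card_bit_strings: "card {s :: bool list. length s = F} = 2 ^ F"
  using card_lists_length_eq[of "UNIV :: bool set" F] by simp

lemma prob_space_bit_strings:
  "prob_space (uniform_count_measure {s :: bool list. length s = F})"
proof (rule prob_space_uniform_count_measure)
  have "replicate F True \<in> {s :: bool list. length s = F}" by simp
  then show "{s :: bool list. length s = F} \<noteq> {}" by blast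
qed (rule finite_bit_strings)

lemma space_file_measure:
  "space (file_measure N F) = {1..N} \<rightarrow>\<^sub>E {s. length s = F}"
  by (simp add: file_measure_def space_PiM space_uniform_count_measure)

lemma information_space_file_measure: "information_space (file_measure N F) 2"
proof -
  interpret prob_space "file_measure N F"
    unfolding file_measure_def by (intro prob_space_PiM prob_space_bit_strings)
  show ?thesis by unfold_locales simp
qed

text \<open>The independent, uniform files are the uniformly distributed tuple of files.\<close>

lemma file_measure_eq_uniform:
  "file_measure N F = uniform_count_measure ({1..N} \<rightarrow>\<^sub>E {s. length s = F})"
proof -
  let ?S = "{s :: bool list. length s = F}"
  let ?P = "{1..N} \<rightarrow>\<^sub>E ?S"
  interpret product_sigma_finite "\<lambda>_ :: nat. uniform_count_measure ?S"
    by (simp add: product_sigma_finite_def prob_space_bit_strings prob_space_imp_sigma_finite)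
  have fin: "finite ?P" by (intro finite_PiE finite_bit_strings) simp
  have sets: "sets (file_measure N F) = Pow ?P"
  proof -
    have "sets (file_measure N F) = sets (\<Pi>\<^sub>M n\<in>{1..N}. count_space ?S)"
      unfolding file_measure_def
      by (intro sets_PiM_cong) (auto simp: sets_uniform_count_measure)
    also have "\<dots> = Pow ?P"
      by (subst count_space_PiM_finite)
        (auto intro: countable_finite finite_bit_strings)
    finally show ?thesis .
  qed
  show ?thesis
  proof (rule measure_eqI_finite[of _ ?P])
    show "sets (file_measure N F) = Pow ?P" by (rule sets)
    show "sets (uniform_count_measure ?P) = Pow ?P" by (simp add: sets_uniform_count_measure)
    show "finite ?P" by (rule fin)
    fix w assume w: "w \<in> ?P"
    have "{w} = Pi\<^sub>E {1..N} (\<lambda>n. {w n})" using w by (simp add: PiE_singleton PiE_iff)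
    then have "emeasure (file_measure N F) {w} =
        (\<Prod>n\<in>{1..N}. emeasure (uniform_count_measure ?S) {w n})"
      unfolding file_measure_def
      using w by (simp only:) (subst emeasure_PiM, auto simp: sets_uniform_count_measure)
    also have "\<dots> = (\<Prod>n\<in>{1..N}. ennreal (1 / 2 ^ F))"
      using w by (intro prod.cong refl, subst emeasure_uniform_count_measure)
        (auto simp: finite_bit_strings card_bit_strings)
    also have "\<dots> = ennreal (1 / real (card ?P))"
      by (simp add: card_PiE card_bit_strings ennreal_power power_one_over)
    also have "\<dots> = emeasure (uniform_count_measure ?P) {w}"
      using w fin by (subst emeasure_uniform_count_measure) auto
    finally show "emeasure (file_measure N F) {w} = emeasure (uniform_count_measure ?P) {w}" .
  qed
qed

end

theory Submission
  imports Defs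
begin

text \<open>
  Put demands \<open>d\<^sub>1, \<dots>, d\<^sub>K\<close> on a cycle, where user \<open>i\<close> alone requests file \<open>N\<close> in \<open>d\<^sub>i\<close>, and let
  \<open>h j\<close> be the joint entropy of the first \<open>N - 1\<close> files, \<open>Z\<^sub>k\<close> and the broadcasts for
  \<open>d\<^sub>k\<^sub>+\<^sub>1, \<dots>, d\<^sub>k\<^sub>+\<^sub>j\<close>; by symmetry it does not depend on \<open>k\<close>.  Adding the users one by one, each
  with its own broadcast, gives \<open>h 0 + \<dots> + h (K - 1) \<ge> K N - 1\<close> by submodularity.  Conversely, a
  cache and \<open>N - 1\<close> broadcasts in which its user requests each of the first \<open>N - 1\<close> files once
  determine these files, so their joint entropy is at most \<open>t = M + (N - 1) R\<close>; two such sets of broadcasts,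
  with union of size \<open>N - 1 + c\<close> and intersection of size \<open>N - 1 - c\<close>, yield
  \<open>h (N - 1 + c) + h (N - 1 - c) \<le> 2 t\<close>.  Since \<open>K - 1 \<le> 2 (N - 1)\<close>, these pairs cover all large
  indices, and \<open>h 0 + \<dots> + h (K - 1) \<le> K t\<close>.
\<close>

section \<open>Entropy of functions of a uniform variable\<close>

text \<open>Shannon entropy in bits of \<open>X\<close> at a uniform point of \<open>S\<close>,
  averaged over sample points instead of values, so that different variables can be compared summand
  by summand.\<close>

definition uniform_entropy :: "'a set \<Rightarrow> ('a \<Rightarrow> 'b) \<Rightarrow> real" where
  "uniform_entropy S X =
     (\<Sum>w\<in>S. log 2 (real (card S) / real (card {v\<in>S. X v = X w}))) / real (card S)"

definition determines :: "'a set \<Rightarrow> ('a \<Rightarrow> 'b) \<Rightarrow> ('a \<Rightarrow> 'c) \<Rightarrow> bool" where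
  "determines S X Y \<longleftrightarrow> (\<forall>v\<in>S. \<forall>w\<in>S. X v = X w \<longrightarrow> Y v = Y w)"

lemma determinesD: "determines S X Y \<Longrightarrow> v \<in> S \<Longrightarrow> w \<in> S \<Longrightarrow> X v = X w \<Longrightarrow> Y v = Y w"
  unfolding determines_def by blast

lemma card_fibre_pos: "finite S \<Longrightarrow> w \<in> S \<Longrightarrow> 0 < card {v\<in>S. X v = X w}"
  by (auto simp: card_gt_0_iff)

lemma entropy_uniform_count_measure:
  assumes fin: "finite S" and ne: "S \<noteq> {}"
  shows "prob_space.entropy (uniform_count_measure S) 2 (count_space (X ` S)) X = uniform_entropy S X"
proof -
  let ?M = "uniform_count_measure S"
  interpret prob_space ?M by (rule prob_space_uniform_count_measure[OF fin ne])
  interpret information_space ?M 2 by unfold_locales simp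
  have sp[simp]: "space ?M = S" by (simp add: space_uniform_count_measure)
  have sf: "simple_function ?M X"
    using fin by (auto simp: simple_function_def sets_uniform_count_measure)
  let ?c = "\<lambda>x. card {v\<in>S. X v = x}"
  have p: "prob (X -` {x} \<inter> S) = real (?c x) / real (card S)" for x
  proof -
    have "X -` {x} \<inter> S = {v\<in>S. X v = x}" by auto
    then show ?thesis using fin by (simp add: measure_uniform_count_measure)
  qed
  have "entropy 2 (count_space (X ` space ?M)) X =
      - (\<Sum>x\<in>X ` space ?M. prob (X -` {x} \<inter> space ?M) * log 2 (prob (X -` {x} \<inter> space ?M)))"
    by (rule entropy_simple_distributed[OF simple_distributedI[OF sf measure_nonneg refl]])
  also have "\<dots> = (\<Sum>x\<in>X ` S. real (?c x) * log 2 (real (card S) / real (?c x)) / real (card S))"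
    unfolding sum_negf[symmetric] sp p
  proof (rule sum.cong[OF refl])
    fix x assume "x \<in> X ` S"
    then have "0 < real (?c x)" "0 < real (card S)"
      using fin ne by (auto simp: card_gt_0_iff)
    then show "- (real (?c x) / real (card S) * log 2 (real (?c x) / real (card S))) =
        real (?c x) * log 2 (real (card S) / real (?c x)) / real (card S)"
      by (simp add: log_divide_pos field_simps)
  qed
  \<comment> \<open>The inner summand is constant on a fibre, so the factor \<open>?c x\<close>
    becomes a sum over its points.\<close>
  also have "\<dots> = (\<Sum>x\<in>X ` S. \<Sum>w\<in>{w\<in>S. X w = x}.
      log 2 (real (card S) / real (?c (X w))) / real (card S))"
    by (rule sum.cong[OF refl]) simp
  also have "\<dots> = uniform_entropy S X"
    unfolding uniform_entropy_def sum_divide_distrib by (rule sum.image_gen[OF fin, symmetric])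
  finally show ?thesis by simp
qed

text \<open>Every fibre of \<open>X\<close> lies in a fibre of \<open>Y\<close>, so the inequality
  holds at each point.\<close>

lemma uniform_entropy_mono:
  assumes "finite S" and "determines S X Y"
  shows "uniform_entropy S Y \<le> uniform_entropy S X"
  unfolding uniform_entropy_def
proof (intro divide_right_mono sum_mono)
  fix w assume w: "w \<in> S"
  have "card {v\<in>S. X v = X w} \<le> card {v\<in>S. Y v = Y w}"
  proof (rule card_mono)
    show "{v\<in>S. X v = X w} \<subseteq> {v\<in>S. Y v = Y w}"
      using w determinesD[OF assms(2), of _ w] by blast
  qed (use assms(1) in simp)
  then have "real (card S) / real (card {v\<in>S. Y v = Y w}) \<le>
      real (card S) / real (card {v\<in>S. X v = X w})"
    using card_fibre_pos[OF assms(1) w, of X] by (intro divide_left_mono) auto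
  then show "log 2 (real (card S) / real (card {v\<in>S. Y v = Y w})) \<le>
      log 2 (real (card S) / real (card {v\<in>S. X v = X w}))"
    \<comment> \<open>The fibre of a constant function is all of \<open>S\<close>; this instance
      gives \<open>card S > 0\<close>.\<close>
    using card_fibre_pos[OF assms(1) w, of Y] card_fibre_pos[OF assms(1) w, of "\<lambda>_. ()"]
    by (intro log_mono divide_pos_pos) simp_all
qed simp

lemma uniform_entropy_eqI:
  "finite S \<Longrightarrow> determines S X Y \<Longrightarrow> determines S Y X \<Longrightarrow> uniform_entropy S X = uniform_entropy S Y"
  by (intro antisym uniform_entropy_mono)

lemma uniform_entropy_const: "finite S \<Longrightarrow> uniform_entropy S (\<lambda>_. c) = 0"
  by (simp add: uniform_entropy_def)

lemma uniform_entropy_nonneg: "finite S \<Longrightarrow> 0 \<le> uniform_entropy S X"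
  using uniform_entropy_mono[of S X "\<lambda>_. ()"] uniform_entropy_const[of S "()"]
  by (simp add: determines_def)

lemma uniform_entropy_inj:
  assumes "finite S" "S \<noteq> {}" "inj_on X S"
  shows "uniform_entropy S X = log 2 (real (card S))"
proof -
  have "{v\<in>S. X v = X w} = {w}" if "w \<in> S" for w
    using assms that by (auto dest: inj_onD)
  then show ?thesis using assms by (simp add: uniform_entropy_def)
qed

lemma uniform_entropy_le_length:
  fixes X :: "'a \<Rightarrow> bool list"
  assumes fin: "finite S" and ne: "S \<noteq> {}" and len: "\<forall>w\<in>S. length (X w) = l"
  shows "uniform_entropy S X \<le> real l"
proof -
  let ?M = "uniform_count_measure S"
  interpret prob_space ?M by (rule prob_space_uniform_count_measure[OF fin ne])
  interpret information_space ?M 2 by unfold_locales simp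
  have sp[simp]: "space ?M = S" by (simp add: space_uniform_count_measure)
  have sf: "simple_function ?M X"
    using fin by (auto simp: simple_function_def sets_uniform_count_measure)
  have "uniform_entropy S X = entropy 2 (count_space (X ` space ?M)) X"
    by (simp add: entropy_uniform_count_measure[OF fin ne])
  also have "\<dots> \<le> log 2 (real (card (X ` space ?M)))"
    by (rule entropy_le_card[OF simple_distributedI[OF sf measure_nonneg refl]])
  also have "\<dots> \<le> log 2 (2 ^ l)"
  proof (rule log_mono)
    have "card (X ` S) \<le> card {s :: bool list. length s = l}"
      using len by (intro card_mono finite_bit_strings) auto
    then show "real (card (X ` space ?M)) \<le> 2 ^ l"
      unfolding card_bit_strings sp by (simp flip: of_nat_le_iff)
    show "0 < real (card (X ` space ?M))" using fin ne by (simp add: card_gt_0_iff)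
  qed simp
  also have "\<dots> = real l" by (simp add: log_nat_power)
  finally show ?thesis .
qed

section \<open>Submodularity of entropy by counting triples\<close>

lemma sum_fibre_inverse_le:
  assumes "finite S"
  shows "(\<Sum>w\<in>{w\<in>S. Y w = y}. 1 / real (card {v\<in>S. Y v = Y w})) \<le> 1"
proof -
  have "(\<Sum>w\<in>{w\<in>S. Y w = y}. 1 / real (card {v\<in>S. Y v = Y w})) =
      (\<Sum>w\<in>{w\<in>S. Y w = y}. 1 / real (card {v\<in>S. Y v = y}))"
    by (rule sum.cong) auto
  also have "\<dots> \<le> 1" by simp
  finally show ?thesis .
qed

text \<open>
  The left-hand side is a weighted count of the triples \<open>(u, v, w)\<close> with \<open>X u = X w\<close> and
  \<open>Y v = Y w\<close>.  All three then agree on \<open>C\<close>, so summing over \<open>w\<close> first gives the bound.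
\<close>

lemma sum_fibre_ratio_le:
  assumes fin: "finite S" and XC: "determines S X C" and YC: "determines S Y C"
  shows "(\<Sum>w\<in>S. real (card {u\<in>S. X u = X w}) * real (card {v\<in>S. Y v = Y w}) /
      (real (card {v\<in>S. X v = X w \<and> Y v = Y w}) * real (card {v\<in>S. C v = C w}))) \<le> real (card S)"
proof -
  let ?p = "\<lambda>w. real (card {v\<in>S. X v = X w \<and> Y v = Y w})"
  let ?c = "\<lambda>w. real (card {v\<in>S. C v = C w})"
  let ?t = "\<lambda>u v w. if X u = X w \<and> Y v = Y w then 1 / (?p w * ?c w) else 0"
  have "(\<Sum>w\<in>S. real (card {u\<in>S. X u = X w}) * real (card {v\<in>S. Y v = Y w}) / (?p w * ?c w)) =
      (\<Sum>w\<in>S. \<Sum>u\<in>S. \<Sum>v\<in>S. ?t u v w)"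
  proof (rule sum.cong[OF refl])
    fix w
    have "(\<Sum>u\<in>S. \<Sum>v\<in>S. ?t u v w) =
        (\<Sum>u\<in>S. if X u = X w then \<Sum>v\<in>S. if Y v = Y w then 1 / (?p w * ?c w) else 0 else 0)"
      by (intro sum.cong refl) auto
    also have "\<dots> = real (card {u\<in>S. X u = X w}) * (real (card {v\<in>S. Y v = Y w}) * (1 / (?p w * ?c w)))"
      using fin by (simp flip: sum.inter_filter)
    finally show "real (card {u\<in>S. X u = X w}) * real (card {v\<in>S. Y v = Y w}) / (?p w * ?c w) =
        (\<Sum>u\<in>S. \<Sum>v\<in>S. ?t u v w)" by simp
  qed
  also have "\<dots> = (\<Sum>u\<in>S. \<Sum>w\<in>S. \<Sum>v\<in>S. ?t u v w)"
    by (rule sum.swap)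
  also have "\<dots> = (\<Sum>u\<in>S. \<Sum>v\<in>S. \<Sum>w\<in>S. ?t u v w)"
    by (intro sum.cong refl sum.swap)
  also have "\<dots> \<le> (\<Sum>u\<in>S. \<Sum>v\<in>S. if C v = C u then 1 / ?c u else 0)"
  proof (intro sum_mono)
    fix u v assume u: "u \<in> S" and v: "v \<in> S"
    show "(\<Sum>w\<in>S. ?t u v w) \<le> (if C v = C u then 1 / ?c u else 0)"
    proof (cases "C v = C u")
      case True
      have "(\<Sum>w\<in>S. ?t u v w) = (\<Sum>w\<in>{w\<in>S. X u = X w \<and> Y v = Y w}. 1 / (?p w * ?c w))"
        using fin by (simp flip: sum.inter_filter)
      also have "\<dots> = (\<Sum>w\<in>{w\<in>S. X u = X w \<and> Y v = Y w}. 1 / ?p w * (1 / ?c u))"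
      proof (rule sum.cong[OF refl])
        fix w assume "w \<in> {w\<in>S. X u = X w \<and> Y v = Y w}"
        then have "C w = C u" using determinesD[OF XC, of u w] u by simp
        then show "1 / (?p w * ?c w) = 1 / ?p w * (1 / ?c u)" by simp
      qed
      \<comment> \<open>The remaining sum runs over one fibre of the pair variable, where the
        inverse fibre sizes add up to at most 1.\<close>
      also have "\<dots> = (\<Sum>w\<in>{w\<in>S. (X w, Y w) = (X u, Y v)}.
          1 / real (card {v\<in>S. (X v, Y v) = (X w, Y w)})) * (1 / ?c u)"
        unfolding sum_distrib_right by (rule sum.cong) auto
      also have "\<dots> \<le> 1 * (1 / ?c u)"
        by (intro mult_right_mono sum_fibre_inverse_le fin) simp
      finally show ?thesis using True by simp
    next
      case False
      have "?t u v w = 0" if w: "w \<in> S" for w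
        using False determinesD[OF XC u w] determinesD[OF YC v w] by auto
      then show ?thesis using False by simp
    qed
  qed
  also have "\<dots> = (\<Sum>u\<in>S. 1)"
  proof (rule sum.cong[OF refl])
    fix u assume "u \<in> S"
    then have "?c u > 0" using card_fibre_pos[OF fin] by simp
    moreover have "(\<Sum>v\<in>S. if C v = C u then 1 / ?c u else 0) = ?c u * (1 / ?c u)"
      using fin by (simp flip: sum.inter_filter)
    ultimately show "(\<Sum>v\<in>S. if C v = C u then 1 / ?c u else 0) = 1"
      by (simp only: times_divide_eq_right mult_1_right divide_self_if) simp
  qed
  finally show ?thesis by simp
qed

text \<open>For \<open>U\<close> the pair \<open>(X, Y)\<close>, left minus right side is the mean
  of \<open>log 2\<close> of the ratios in \<open>sum_fibre_ratio_le\<close>; that bound and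
  \<open>ln a \<le> a - 1\<close> make it nonpositive. Monotonicity gives every other
  \<open>U\<close>, which leaves room for decoded files.\<close>

lemma uniform_entropy_submodular:
  assumes fin: "finite S" and XC: "determines S X C" and YC: "determines S Y C"
    and XYU: "determines S (\<lambda>w. (X w, Y w)) U"
  shows "uniform_entropy S U + uniform_entropy S C \<le> uniform_entropy S X + uniform_entropy S Y"
proof (cases "S = {}")
  case True
  then show ?thesis by (simp add: uniform_entropy_def)
next
  case False
  then have s: "0 < real (card S)" using fin by (simp add: card_gt_0_iff)
  let ?P = "\<lambda>w. (X w, Y w)"
  let ?x = "\<lambda>w. real (card {v\<in>S. X v = X w})" and ?y = "\<lambda>w. real (card {v\<in>S. Y v = Y w})"
  let ?p = "\<lambda>w. real (card {v\<in>S. X v = X w \<and> Y v = Y w})"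
  let ?c = "\<lambda>w. real (card {v\<in>S. C v = C w})"
  let ?l = "\<lambda>a. log 2 (real (card S) / a)"
  have pos: "0 < ?x w" "0 < ?y w" "0 < ?p w" "0 < ?c w" if "w \<in> S" for w
    using card_fibre_pos[OF fin that, of X] card_fibre_pos[OF fin that, of Y]
      card_fibre_pos[OF fin that, of C] card_fibre_pos[OF fin that, of ?P] by auto
  have "(\<Sum>w\<in>S. ?l (?p w)) + (\<Sum>w\<in>S. ?l (?c w)) - (\<Sum>w\<in>S. ?l (?x w)) - (\<Sum>w\<in>S. ?l (?y w)) =
      (\<Sum>w\<in>S. log 2 (?x w * ?y w / (?p w * ?c w)))"
    unfolding sum.distrib[symmetric] sum_subtractf[symmetric]
    using pos s by (intro sum.cong refl) (simp add: log_divide_pos log_mult_pos)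
  also have "\<dots> \<le> (\<Sum>w\<in>S. (?x w * ?y w / (?p w * ?c w) - 1) / ln 2)"
  proof (rule sum_mono)
    fix w assume w: "w \<in> S"
    have "ln (?x w * ?y w / (?p w * ?c w)) \<le> ?x w * ?y w / (?p w * ?c w) - 1"
      by (intro ln_le_minus_one divide_pos_pos mult_pos_pos pos[OF w])
    then show "log 2 (?x w * ?y w / (?p w * ?c w)) \<le> (?x w * ?y w / (?p w * ?c w) - 1) / ln 2"
      unfolding log_def by (intro divide_right_mono) simp_all
  qed
  also have "\<dots> = ((\<Sum>w\<in>S. ?x w * ?y w / (?p w * ?c w)) - real (card S)) / ln 2"
    by (simp add: sum_subtractf flip: sum_divide_distrib)
  also have "\<dots> \<le> 0"
    using sum_fibre_ratio_le[OF fin XC YC] by (intro divide_nonpos_pos) auto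
  finally have "uniform_entropy S ?P + uniform_entropy S C \<le> uniform_entropy S X + uniform_entropy S Y"
    using s unfolding uniform_entropy_def prod.inject add_divide_distrib[symmetric]
    by (intro divide_right_mono) linarith+
  moreover have "uniform_entropy S U \<le> uniform_entropy S ?P"
    by (rule uniform_entropy_mono[OF fin XYU])
  ultimately show ?thesis by linarith
qed

section \<open>Transfer to the space of files\<close>

lemma finite_space_file_measure: "finite (space (file_measure N F))"
  unfolding space_file_measure by (intro finite_PiE finite_bit_strings) simp

lemma space_file_measure_nonempty: "space (file_measure N F) \<noteq> {}"
proof -
  have "(\<lambda>n\<in>{1..N}. replicate F True) \<in> space (file_measure N F)"
    unfolding space_file_measure by auto
  then show ?thesis by blast
qed

lemma normalized_entropy_eq:
  "normalized_entropy N F Y = uniform_entropy (space (file_measure N F)) Y / real F"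
proof -
  have "file_measure N F = uniform_count_measure (space (file_measure N F))"
    unfolding space_file_measure by (rule file_measure_eq_uniform)
  from arg_cong[OF this, of "\<lambda>M. prob_space.entropy M 2 (count_space (Y ` space (file_measure N F))) Y"]
  show ?thesis
    unfolding normalized_entropy_def
    by (simp only: entropy_uniform_count_measure[OF finite_space_file_measure space_file_measure_nonempty])
qed

section \<open>Joint entropies in a symmetric caching scheme\<close>

text \<open>The tuple of the symmetry condition; restriction gives all subfamilies one common
  type.\<close>

definition observation ::
  "(nat \<Rightarrow> (nat \<Rightarrow> bool list) \<Rightarrow> bool list) \<Rightarrow> ((nat \<Rightarrow> nat) \<Rightarrow> (nat \<Rightarrow> bool list) \<Rightarrow> bool list)
    \<Rightarrow> nat set \<Rightarrow> nat set \<Rightarrow> (nat \<Rightarrow> nat) set \<Rightarrow> (nat \<Rightarrow> bool list)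
    \<Rightarrow> (nat \<Rightarrow> bool list) \<times> (nat \<Rightarrow> bool list) \<times> ((nat \<Rightarrow> nat) \<Rightarrow> bool list)" where
  "observation Z X A B E w = (\<lambda>n\<in>A. w n, \<lambda>k\<in>B. Z k w, \<lambda>d\<in>E. X d w)"

lemma restrict_eq_iff: "restrict f A = restrict g A \<longleftrightarrow> (\<forall>x\<in>A. f x = g x)"
  by (metis restrict_apply' restrict_ext)

lemma observation_eq_iff:
  "observation Z X A B E v = observation Z X A B E w \<longleftrightarrow>
     (\<forall>n\<in>A. v n = w n) \<and> (\<forall>k\<in>B. Z k v = Z k w) \<and> (\<forall>d\<in>E. X d v = X d w)"
  by (simp add: observation_def restrict_eq_iff)

locale symmetric_caching =
  fixes N K F :: nat and M R :: real
    and Z :: "nat \<Rightarrow> (nat \<Rightarrow> bool list) \<Rightarrow> bool list"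
    and X :: "(nat \<Rightarrow> nat) \<Rightarrow> (nat \<Rightarrow> bool list) \<Rightarrow> bool list"
  assumes scheme: "caching_scheme N K M R F Z X"
    and sym: "symmetric_scheme N K F Z X"
    and rate_nonneg: "0 \<le> R"
begin

abbreviation S where "S \<equiv> space (file_measure N F)"

text \<open>Measured in bits, not divided by \<open>F\<close>; hence the factors
  \<open>real F\<close> below.\<close>

definition ent :: "nat set \<Rightarrow> nat set \<Rightarrow> (nat \<Rightarrow> nat) set \<Rightarrow> real" where
  "ent A B E = uniform_entropy S (observation Z X A B E)"

lemma F_pos: "0 < F"
  using scheme by (simp add: caching_scheme_def)

lemma decode:
  assumes "d \<in> demands N K" "k \<in> {1..K}" "v \<in> S" "w \<in> S" "Z k v = Z k w" "X d v = X d w"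
  shows "v (d k) = w (d k)"
proof -
  obtain dec where "\<forall>w\<in>S. w (d k) = dec (Z k w) (X d w)"
    using scheme assms(1,2) unfolding caching_scheme_def by metis
  then show ?thesis using assms(3-6) by metis
qed

lemma ent_nonneg: "0 \<le> ent A B E"
  unfolding ent_def by (rule uniform_entropy_nonneg[OF finite_space_file_measure])

text \<open>Decoding is built in: the joint part may also contain any file decodable from a cache
  and a broadcast of the two sides, even if these come from different sides.\<close>

lemma ent_submodular:
  assumes "B1 \<subseteq> {1..K}" "B2 \<subseteq> {1..K}" "E1 \<subseteq> demands N K" "E2 \<subseteq> demands N K"
    and "A0 \<subseteq> A1 \<inter> A2" "B0 \<subseteq> B1 \<inter> B2" "E0 \<subseteq> E1 \<inter> E2"
    and "A \<subseteq> A1 \<union> A2 \<union> {d k |d k. d \<in> E1 \<union> E2 \<and> k \<in> B1 \<union> B2}" "B \<subseteq> B1 \<union> B2" "E \<subseteq> E1 \<union> E2"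
  shows "ent A B E + ent A0 B0 E0 \<le> ent A1 B1 E1 + ent A2 B2 E2"
  unfolding ent_def
proof (rule uniform_entropy_submodular[OF finite_space_file_measure])
  show "determines S (observation Z X A1 B1 E1) (observation Z X A0 B0 E0)"
    "determines S (observation Z X A2 B2 E2) (observation Z X A0 B0 E0)"
    using assms(5-7) by (auto simp: determines_def observation_eq_iff)
  show "determines S (\<lambda>w. (observation Z X A1 B1 E1 w, observation Z X A2 B2 E2 w))
      (observation Z X A B E)"
    unfolding determines_def
  proof (intro ballI impI)
    fix v w
    assume vw: "v \<in> S" "w \<in> S" and "(observation Z X A1 B1 E1 v, observation Z X A2 B2 E2 v) =
      (observation Z X A1 B1 E1 w, observation Z X A2 B2 E2 w)"
    then have A: "\<forall>n\<in>A1 \<union> A2. v n = w n" and Z: "\<forall>k\<in>B1 \<union> B2. Z k v = Z k w"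
      and X: "\<forall>d\<in>E1 \<union> E2. X d v = X d w"
      by (auto simp: observation_eq_iff)
    have "v (d k) = w (d k)" if "d \<in> E1 \<union> E2" "k \<in> B1 \<union> B2" for d k
      using that assms(1-4) vw Z X by (intro decode[of d k v w]) blast+
    then have "\<forall>n\<in>A. v n = w n" using A assms(8) by blast
    then show "observation Z X A B E v = observation Z X A B E w"
      using Z X assms(9,10) by (auto simp: observation_eq_iff)
  qed
qed

lemma ent_mono:
  assumes "B' \<subseteq> {1..K}" "E' \<subseteq> demands N K"
    and "A \<subseteq> A' \<union> {d k |d k. d \<in> E' \<and> k \<in> B'}" "B \<subseteq> B'" "E \<subseteq> E'"
  shows "ent A B E \<le> ent A' B' E'"
  using ent_submodular[of B' B' E' E' A' A' A' B' E' A B E] assms by simp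

lemma ent_le_length:
  fixes Y :: "(nat \<Rightarrow> bool list) \<Rightarrow> bool list"
  assumes "\<forall>w\<in>S. length (Y w) = l" "determines S Y (observation Z X A B E)"
  shows "ent A B E \<le> real l"
  unfolding ent_def
  using uniform_entropy_mono[OF finite_space_file_measure assms(2)]
    uniform_entropy_le_length[OF finite_space_file_measure space_file_measure_nonempty assms(1)]
  by linarith

lemma ent_file_le: "n \<in> {1..N} \<Longrightarrow> ent {n} {} {} \<le> real F"
  by (rule ent_le_length[of "\<lambda>w. w n"])
    (auto simp: space_file_measure determines_def observation_eq_iff PiE_iff)

lemma ent_cache_le:
  assumes "k \<in> {1..K}"
  shows "ent {} {k} {} \<le> M * real F"
proof -
  obtain l where "real l \<le> M * real F" "\<forall>w\<in>S. length (Z k w) = l"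
    using scheme assms unfolding caching_scheme_def at_most_bits_def by blast
  then show ?thesis
    using ent_le_length[of "Z k" l "{}" "{k}" "{}"]
    by (auto simp: determines_def observation_eq_iff)
qed

lemma ent_broadcast_le:
  assumes "d \<in> demands N K"
  shows "ent {} {} {d} \<le> R * real F"
proof -
  obtain l where "real l \<le> R * real F" "\<forall>w\<in>S. length (X d w) = l"
    using scheme assms unfolding caching_scheme_def at_most_bits_def by blast
  then show ?thesis
    using ent_le_length[of "X d" l "{}" "{}" "{d}"]
    by (auto simp: determines_def observation_eq_iff)
qed

lemma ent_cache_broadcasts_le:
  assumes "k \<in> {1..K}" "finite E" "E \<subseteq> demands N K"
  shows "ent {} {k} E \<le> (M + real (card E) * R) * real F"
  using assms(2,3)
proof (induction E rule: finite_induct)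
  case empty
  then show ?case using ent_cache_le[OF assms(1)] by simp
next
  case (insert d E)
  have "ent {} {k} (insert d E) + ent {} {} {} \<le> ent {} {k} E + ent {} {} {d}"
    using insert assms(1) by (intro ent_submodular) auto
  moreover have "ent {} {k} E \<le> (M + real (card E) * R) * real F"
    using insert by simp
  moreover have "ent {} {} {d} \<le> R * real F"
    using insert by (intro ent_broadcast_le) auto
  ultimately show ?case
    using insert ent_nonneg[of "{}" "{}" "{}"] by (simp add: algebra_simps)
qed

text \<open>The tuple of all files identifies the sample point, and there are
  \<open>2 ^ (F * N)\<close> of them.\<close>

lemma ent_all_files: "real N * real F \<le> ent {1..N} {} {}"
proof -
  have "inj_on (observation Z X {1..N} {} {}) S"
  proof (rule inj_onI)
    fix v w assume "v \<in> S" "w \<in> S" "observation Z X {1..N} {} {} v = observation Z X {1..N} {} {} w"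
    then show "v = w"
      unfolding space_file_measure observation_eq_iff by (intro PiE_ext) auto
  qed
  then have "ent {1..N} {} {} = log 2 (real (card S))"
    unfolding ent_def
    by (rule uniform_entropy_inj[OF finite_space_file_measure space_file_measure_nonempty])
  also have "\<dots> = log 2 (2 ^ (F * N))"
    by (simp add: space_file_measure card_PiE card_bit_strings power_mult)
  also have "\<dots> = real (F * N)"
    by (simp only: log_nat_power) simp
  finally show ?thesis by simp
qed

lemma ent_all_files_le:
  assumes "B \<subseteq> {1..K}" "E \<subseteq> demands N K" "{1..N} \<subseteq> A \<union> {d k |d k. d \<in> E \<and> k \<in> B}"
  shows "real N * real F \<le> ent A B E"
  using ent_all_files ent_mono[of B E "{1..N}" A "{}" "{}"] assms by simp

lemma ent_all_but_last_file:
  assumes "0 < N"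
  shows "(real N - 1) * real F \<le> ent {1..<N} {} {}"
proof -
  have "ent {1..N} {} {} + ent {} {} {} \<le> ent {1..<N} {} {} + ent {N} {} {}"
    by (intro ent_submodular) auto
  then show ?thesis
    using ent_all_files ent_nonneg[of "{}" "{}" "{}"] ent_file_le[of N] assms
    by (simp add: algebra_simps)
qed

lemma ent_permute_users:
  assumes "\<pi> permutes {1..K}" "A \<subseteq> {1..N}" "B \<subseteq> {1..K}" "E \<subseteq> demands N K"
  shows "ent A (\<pi> ` B) (permute_demand K \<pi> id ` E) = ent A B E"
proof -
  let ?Y = "\<lambda>w. (\<lambda>n\<in>A. w (id n), \<lambda>k\<in>B. Z (\<pi> k) w, \<lambda>d\<in>E. X (permute_demand K \<pi> id d) w)"
  have "normalized_entropy N F (observation Z X A B E) = normalized_entropy N F ?Y"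
    unfolding observation_def
    using sym assms permutes_id[of "{1..N}"] unfolding symmetric_scheme_def by blast
  then have "ent A B E = uniform_entropy S ?Y"
    unfolding normalized_entropy_eq ent_def using F_pos by simp
  \<comment> \<open>Indexing by \<open>B\<close> and reading \<open>Z (\<pi> k)\<close>, or indexing
    by the image, gives tuples that determine each other; likewise for demands.\<close>
  also have "\<dots> = ent A (\<pi> ` B) (permute_demand K \<pi> id ` E)"
    unfolding ent_def
    by (rule uniform_entropy_eqI[OF finite_space_file_measure])
      (auto simp: determines_def observation_eq_iff restrict_eq_iff)
  finally show ?thesis by simp
qed

end

section \<open>A cyclic family of demands\<close>

text \<open>
  In the \<open>i\<close>-th demand, the user \<open>r\<close> places before \<open>i\<close> on the cycle asks for the file
  \<open>folded N r\<close>.  The files \<open>1, \<dots>, N - 1\<close> are traversed forwards for \<open>r < N\<close> and backwards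
  for \<open>r \<ge> N\<close>, so the steps \<open>{1..<N - c}\<close> and \<open>{N..<N + c}\<close> together meet each of them exactly once.
\<close>

definition folded :: "nat \<Rightarrow> nat \<Rightarrow> nat" where
  "folded N r = (if r = 0 then N else if r < N then r else 2 * N - 1 - r)"

definition cyclic_demand :: "nat \<Rightarrow> nat \<Rightarrow> nat \<Rightarrow> nat \<Rightarrow> nat" where
  "cyclic_demand N K i = (\<lambda>x\<in>{1..K}. folded N (if x \<le> i then i - x else i + K - x))"

text \<open>The cyclic shift by \<open>k - 1\<close>, which takes user 1 to user \<open>k\<close>;
  it fixes everything outside \<open>{1..K}\<close>, as a permutation of that set must.\<close>

definition rotation :: "nat \<Rightarrow> nat \<Rightarrow> nat \<Rightarrow> nat" where
  "rotation K k x =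
     (if x \<in> {1..K} then if x + k \<le> K + 1 then x + k - 1 else x + k - 1 - K else x)"

lemma rotation_permutes:
  assumes "k \<in> {1..K}"
  shows "rotation K k permutes {1..K}"
proof (rule bij_imp_permutes)
  have "inj_on (rotation K k) {1..K}"
    using assms by (auto simp: inj_on_def rotation_def split: if_splits)
  moreover have "rotation K k ` {1..K} \<subseteq> {1..K}"
    using assms by (auto simp: rotation_def)
  ultimately show "bij_betw (rotation K k) {1..K} {1..K}"
    by (simp add: bij_betw_def endo_inj_surj)
qed (auto simp: rotation_def)

text \<open>A demand depends only on the cyclic distance from a user to \<open>i\<close>, which
  rotation preserves.\<close>

lemma permute_cyclic_demand:
  assumes k: "k \<in> {1..K}" and i: "i \<in> {1..K}"
  shows "permute_demand K (rotation K k) id (cyclic_demand N K i) = cyclic_demand N K (rotation K k i)"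
proof
  fix y
  let ?\<pi> = "rotation K k"
  note \<pi> = rotation_permutes[OF k]
  show "permute_demand K ?\<pi> id (cyclic_demand N K i) y = cyclic_demand N K (?\<pi> i) y"
  proof (cases "y \<in> {1..K}")
    case True
    then obtain x where x: "x \<in> {1..K}" and y: "y = ?\<pi> x"
      using permutes_image[OF \<pi>] by blast
    have "inv ?\<pi> y = x" using y permutes_inverses(2)[OF \<pi>] by simp
    moreover have "(if x \<le> i then i - x else i + K - x) =
        (if ?\<pi> x \<le> ?\<pi> i then ?\<pi> i - ?\<pi> x else ?\<pi> i + K - ?\<pi> x)"
      using x i k by (auto simp: rotation_def)
    ultimately show ?thesis
      using True x y by (simp add: permute_demand_def cyclic_demand_def)
  next
    case False
    then show ?thesis by (auto simp: permute_demand_def cyclic_demand_def)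
  qed
qed

lemma cyclic_demand_in_demands:
  assumes "0 < N" "N \<le> K" "K < 2 * N" "i \<in> {1..K}"
  shows "cyclic_demand N K i \<in> demands N K"
proof -
  have "cyclic_demand N K i x \<in> {1..N}" if "x \<in> {1..K}" for x
    \<comment> \<open>Distances are at most \<open>K - 1 \<le> 2 * N - 2\<close>, so the backward
      values \<open>2 * N - 1 - r\<close> stay positive.\<close>
    using that assms by (auto simp: cyclic_demand_def folded_def)
  moreover have "v \<in> cyclic_demand N K i ` {1..K}" if v: "v \<in> {1..N}" for v
  proof -
    \<comment> \<open>The distance in the forward range at which file \<open>v\<close> is requested;
      \<open>x\<close> is the user that far before \<open>i\<close>.\<close>
    define r where "r = (if v = N then 0 else v)"
    define x where "x = (if r < i then i - r else i + K - r)"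
    have x: "x \<in> {1..K}" using v assms by (auto simp: x_def r_def)
    have "(if x \<le> i then i - x else i + K - x) = r"
      using v assms by (auto simp: x_def r_def)
    moreover have "folded N r = v" using v assms by (auto simp: folded_def r_def)
    ultimately have "cyclic_demand N K i x = v" using x by (simp add: cyclic_demand_def)
    then show ?thesis using x by blast
  qed
  ultimately show ?thesis
    unfolding demands_def by (auto simp: cyclic_demand_def)
qed

section \<open>The trade-off\<close>

lemma sum_le_of_folded_pairs:
  fixes h :: "nat \<Rightarrow> real"
  assumes nK: "n < K" and Kn: "K \<le> 2 * n + 1"
    and mono: "\<And>j. j \<le> n \<Longrightarrow> h j \<le> t"
    and pair: "\<And>c. c \<le> n \<Longrightarrow> n + c < K \<Longrightarrow> h (n + c) + h (n - c) \<le> 2 * t"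
  shows "(\<Sum>j<K. h j) \<le> real K * t"
proof -
  \<comment> \<open>Then \<open>2 * n - a = K - 1\<close>: the block \<open>{a..K - 1}\<close> is
    symmetric about \<open>n\<close>, and indices below \<open>a\<close> are bounded singly by
    \<open>mono\<close>.\<close>
  define a where "a = 2 * n + 1 - K"
  have a: "a \<le> n" "K = a + (2 * (n - a) + 1)" using assms(1,2) by (auto simp: a_def)
  \<comment> \<open>Adding the reversed sum pairs \<open>j\<close> with \<open>2 * n - j\<close>;
    the middle index is paired with itself, the case \<open>c = 0\<close>.\<close>
  have "2 * (\<Sum>j=a..2*n-a. h j) = (\<Sum>j=a..2*n-a. h j) + (\<Sum>j=a..2*n-a. h (2*n-a+a-j))"
    by (subst sum.atLeastAtMost_rev) simp
  also have "\<dots> = (\<Sum>j=a..2*n-a. h j + h (2*n-j))"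
  proof -
    have "2 * n - a + a = 2 * n" using a(1) by simp
    then show ?thesis by (simp only: sum.distrib)
  qed
  also have "\<dots> \<le> (\<Sum>j=a..2*n-a. 2 * t)"
  proof (rule sum_mono)
    fix j assume j: "j \<in> {a..2*n-a}"
    show "h j + h (2*n-j) \<le> 2 * t"
    proof (cases "j \<le> n")
      case True
      then have "n + (n - j) < K" "n + (n - j) = 2 * n - j" "n - (n - j) = j"
        using j a unfolding atLeastAtMost_iff by arith+
      then show ?thesis using pair[of "n - j"] by simp
    next
      case False
      then have "j - n \<le> n" "n + (j - n) < K" "n + (j - n) = j" "n - (j - n) = 2 * n - j"
        using j a unfolding atLeastAtMost_iff by arith+
      then show ?thesis using pair[of "j - n"] by simp
    qed
  qed
  finally have "(\<Sum>j=a..2*n-a. h j) \<le> real (2*n-a+1-a) * t" by simp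
  moreover have "(\<Sum>j<a. h j) \<le> (\<Sum>j<a. t)" using a by (intro sum_mono mono) auto
  moreover have "(\<Sum>j<K. h j) = (\<Sum>j<a. h j) + (\<Sum>j=a..2*n-a. h j)"
  proof -
    have "{..<K} = {..<a} \<union> {a..2*n-a}" using a by auto
    then show ?thesis by (simp add: sum.union_disjoint ivl_disj_int)
  qed
  moreover have "real K = real a + real (2*n-a+1-a)" using a by (simp flip: of_nat_add)
  ultimately show ?thesis by (simp add: algebra_simps)
qed

locale folded_caching = symmetric_caching +
  assumes two_files: "2 \<le> N" and N_le: "N \<le> K" and K_less: "K < 2 * N"
begin

abbreviation dem where "dem \<equiv> cyclic_demand N K"

text \<open>The \<open>h j\<close> of the overview at \<open>k = 1\<close>: demands \<open>2\<close>
  to \<open>j + 1\<close> are the \<open>j\<close> demands after user 1's own.\<close>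

definition window_ent :: "nat \<Rightarrow> real" where
  "window_ent j = ent {1..<N} {1} (dem ` {2..Suc j})"

lemma dem_subset: "I \<subseteq> {1..K} \<Longrightarrow> dem ` I \<subseteq> demands N K"
  using cyclic_demand_in_demands[of N K] two_files N_le K_less by auto

lemma dem_self: "i \<in> {1..K} \<Longrightarrow> dem i i = N"
  by (simp add: cyclic_demand_def folded_def)

lemma dem_first: "r < K \<Longrightarrow> dem (Suc r) 1 = folded N r"
  using two_files N_le by (simp add: cyclic_demand_def)

text \<open>Rotation by \<open>k - 1\<close> takes user 1 to \<open>k\<close> and demands
  \<open>2..K - k + 1\<close> to \<open>k + 1..K\<close> without wrapping around.\<close>

lemma ent_suffix: "k \<in> {1..K} \<Longrightarrow> ent {1..<N} {k} (dem ` {k+1..K}) = window_ent (K - k)"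
proof -
  assume k: "k \<in> {1..K}"
  have "rotation K k 1 = k" using k by (auto simp: rotation_def)
  moreover have "permute_demand K (rotation K k) id ` dem ` {2..Suc (K - k)} = dem ` {k+1..K}"
  proof -
    have "rotation K k i = i + (k - 1)" if "i \<in> {2..Suc (K - k)}" for i
      using that k by (auto simp: rotation_def)
    then have "permute_demand K (rotation K k) id (dem i) = dem (i + (k - 1))"
      if "i \<in> {2..Suc (K - k)}" for i
      using permute_cyclic_demand[OF k, of i N] that k by auto
    then have "permute_demand K (rotation K k) id ` dem ` {2..Suc (K - k)} =
        dem ` (\<lambda>i. i + (k - 1)) ` {2..Suc (K - k)}"
      unfolding image_image by (intro image_cong) auto
    also have "(\<lambda>i. i + (k - 1)) ` {2..Suc (K - k)} = {k+1..K}"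
      using k unfolding image_add_atLeastAtMost' atLeastAtMost_iff by (intro arg_cong2[of _ _ _ _ atLeastAtMost]) arith+
    finally show ?thesis .
  qed
  ultimately show ?thesis
    using ent_permute_users[OF rotation_permutes[OF k], of "{1..<N}" "{1}" "dem ` {2..Suc (K - k)}"]
      dem_subset[of "{2..Suc (K - k)}"] k
    by (fastforce simp: window_ent_def)
qed

text \<open>User 1 decodes file \<open>folded N r\<close> from demand \<open>Suc r\<close>, so by
  \<open>cover\<close> the files come free; only one cache and at most \<open>N - 1\<close>
  broadcasts count.\<close>

lemma ent_rainbow_le:
  assumes C: "C \<subseteq> {1..<K}" "card C = N - 1" and cover: "{1..<N} \<subseteq> folded N ` C"
  shows "ent {1..<N} {1} (dem ` Suc ` C) \<le> (M + (real N - 1) * R) * real F"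
proof -
  have finC: "finite C" using C(1) finite_subset by blast
  have E: "dem ` Suc ` C \<subseteq> demands N K" using C(1) by (intro dem_subset) auto
  have "{1..<N} \<subseteq> {d k |d k. d \<in> dem ` Suc ` C \<and> k \<in> {1}}"
  proof
    fix v assume "v \<in> {1..<N}"
    then obtain r where r: "r \<in> C" "v = folded N r" using cover by blast
    then have "v = dem (Suc r) 1" using C(1) dem_first[of r] by auto
    then show "v \<in> {d k |d k. d \<in> dem ` Suc ` C \<and> k \<in> {1}}" using r by auto
  qed
  then have "ent {1..<N} {1} (dem ` Suc ` C) \<le> ent {} {1} (dem ` Suc ` C)"
    using E two_files N_le by (intro ent_mono) auto
  also have "\<dots> \<le> (M + real (card (dem ` Suc ` C)) * R) * real F"
    using E finC two_files N_le by (intro ent_cache_broadcasts_le) auto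
  also have "\<dots> \<le> (M + (real N - 1) * R) * real F"
  proof -
    have "card (dem ` Suc ` C) \<le> N - 1"
      unfolding image_image using card_image_le[OF finC] C(2) by metis
    then have "real (card (dem ` Suc ` C)) \<le> real N - 1" using two_files by linarith
    then show ?thesis using rate_nonneg by (intro mult_right_mono add_left_mono) auto
  qed
  finally show ?thesis .
qed

lemma window_ent_pair_le:
  assumes c: "c \<le> N - 1" "N - 1 + c < K"
  shows "window_ent (N - 1 + c) + window_ent (N - 1 - c) \<le> 2 * ((M + (real N - 1) * R) * real F)"
proof -
  \<comment> \<open>The last \<open>c\<close> steps of \<open>{1..<N}\<close> are replaced by their
    mirror images under \<open>r \<mapsto> 2 * N - 1 - r\<close>, which request the same files.
    Union and intersection with \<open>{1..<N}\<close> are \<open>{1..<N + c}\<close> and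
    \<open>{1..<N - c}\<close>.\<close>
  define C where "C = {1..<N - c} \<union> {N..<N + c}"
  have sub: "{1..<N} \<subseteq> {1..<K}" "C \<subseteq> {1..<K}" using c N_le two_files by (auto simp: C_def)
  have "card C = N - 1"
    unfolding C_def using c two_files by (subst card_Un_disjoint) auto
  moreover have "{1..<N} \<subseteq> folded N ` C"
  proof
    fix v assume v: "v \<in> {1..<N}"
    show "v \<in> folded N ` C"
    proof (cases "v < N - c")
      case True
      then have "v \<in> C" "folded N v = v" using v by (auto simp: C_def folded_def)
      then show ?thesis by force
    next
      case False
      then have "2 * N - 1 - v \<in> C" "folded N (2 * N - 1 - v) = v"
        using v c by (auto simp: C_def folded_def)
      then show ?thesis by force
    qed
  qed
  ultimately have 1: "ent {1..<N} {1} (dem ` Suc ` C) \<le> (M + (real N - 1) * R) * real F"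
    using sub by (intro ent_rainbow_le)
  have 2: "ent {1..<N} {1} (dem ` Suc ` {1..<N}) \<le> (M + (real N - 1) * R) * real F"
    using sub by (intro ent_rainbow_le) (auto simp: folded_def image_iff)
  have 3: "dem ` Suc ` C \<subseteq> demands N K" "dem ` Suc ` {1..<N} \<subseteq> demands N K"
    using sub by (auto intro!: dem_subset[THEN subsetD])
  have "{2..Suc (N - 1 + c)} \<subseteq> Suc ` C \<union> Suc ` {1..<N}"
  proof
    fix i assume "i \<in> {2..Suc (N - 1 + c)}"
    then have "i = Suc (i - 1)" "i - 1 \<in> C \<union> {1..<N}" using two_files by (auto simp: C_def)
    then show "i \<in> Suc ` C \<union> Suc ` {1..<N}" by blast
  qed
  then have 4: "dem ` {2..Suc (N - 1 + c)} \<subseteq> dem ` Suc ` C \<union> dem ` Suc ` {1..<N}"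
    by blast
  have "{2..Suc (N - 1 - c)} \<subseteq> Suc ` (C \<inter> {1..<N})"
  proof
    fix i assume "i \<in> {2..Suc (N - 1 - c)}"
    then have "i = Suc (i - 1)" "i - 1 \<in> C \<inter> {1..<N}" using c by (auto simp: C_def)
    then show "i \<in> Suc ` (C \<inter> {1..<N})" by blast
  qed
  then have 5: "dem ` {2..Suc (N - 1 - c)} \<subseteq> dem ` Suc ` C \<inter> dem ` Suc ` {1..<N}"
    by blast
  have "window_ent (N - 1 + c) + window_ent (N - 1 - c) \<le>
      ent {1..<N} {1} (dem ` Suc ` C) + ent {1..<N} {1} (dem ` Suc ` {1..<N})"
    unfolding window_ent_def
    using 3 4 5 two_files N_le by (intro ent_submodular) auto
  then show ?thesis using 1 2 by linarith
qed

text \<open>The pair bound at \<open>c = 0\<close> bounds index \<open>N - 1\<close>; smaller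
  windows follow by monotonicity.\<close>

lemma window_ent_le:
  assumes "j \<le> N - 1"
  shows "window_ent j \<le> (M + (real N - 1) * R) * real F"
proof -
  have "window_ent j \<le> window_ent (N - 1)"
    unfolding window_ent_def
    using assms two_files N_le by (intro ent_mono dem_subset) auto
  moreover have "N - 1 < K" using two_files N_le by linarith
  ultimately show ?thesis using window_ent_pair_le[of 0] by simp
qed

text \<open>
  The step uses that the first \<open>N - 1\<close> files, \<open>Z\<^sub>k\<close> and the \<open>k\<close>-th broadcast determine all files.
\<close>

lemma ent_chain:
  assumes "j < K"
  shows "real j * (real N * real F) + (real N - 1) * real F \<le>
    (\<Sum>i<j. window_ent i) + ent {1..<N} {} (dem ` {K - j + 1..K})"
  using assms
proof (induction j)
  case 0
  \<comment> \<open>No broadcast is left over for \<open>j = 0\<close>, only the first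
    \<open>N - 1\<close> files.\<close>
  then show ?case using ent_all_but_last_file two_files by simp
next
  case (Suc j)
  let ?k = "K - j"
  have k: "?k \<in> {1..K}" and Kj: "K - Suc j + 1 = ?k" "K - ?k = j" using Suc.prems by auto
  \<comment> \<open>One side holds the cache of user \<open>?k\<close>, the other its broadcast;
    they share the files and the later broadcasts.\<close>
  have "ent {1..<N} {?k} (dem ` {?k..K}) + ent {1..<N} {} (dem ` {?k+1..K}) \<le>
      ent {1..<N} {?k} (dem ` {?k+1..K}) + ent {1..<N} {} (dem ` {?k..K})"
    using k dem_subset[of "{?k..K}"] dem_subset[of "{?k+1..K}"]
    by (intro ent_submodular) auto
  moreover have "real N * real F \<le> ent {1..<N} {?k} (dem ` {?k..K})"
  proof (rule ent_all_files_le)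
    show "{1..N} \<subseteq> {1..<N} \<union> {d k |d k. d \<in> dem ` {?k..K} \<and> k \<in> {?k}}"
    proof
      fix v assume "v \<in> {1..N}"
      then have "v \<in> {1..<N} \<or> v = dem ?k ?k" using dem_self[OF k] by auto
      then show "v \<in> {1..<N} \<union> {d k |d k. d \<in> dem ` {?k..K} \<and> k \<in> {?k}}" using k by auto
    qed
  qed (use k in \<open>auto intro!: dem_subset[THEN subsetD]\<close>)
  moreover have "ent {1..<N} {?k} (dem ` {?k+1..K}) = window_ent j"
    using ent_suffix[OF k] Kj by simp
  ultimately show ?case
    using Suc Kj by (simp add: algebra_simps)
qed

text \<open>The chain stops after users \<open>K\<close> down to \<open>2\<close>. The broadcasts
  then left over, \<open>2..K\<close>, are those of the last window, so adding \<open>Z 1\<close>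
  bounds them by \<open>window_ent (K - 1)\<close>.\<close>

lemma sum_window_ent_ge: "(real K * real N - 1) * real F \<le> (\<Sum>j<K. window_ent j)"
proof -
  have K: "K - (K - 1) + 1 = 2" "K = Suc (K - 1)" using two_files N_le by auto
  have "ent {1..<N} {} (dem ` {2..K}) \<le> ent {1..<N} {1} (dem ` {2..Suc (K - 1)})"
    using two_files N_le by (intro ent_mono dem_subset) auto
  moreover have "(\<Sum>j<K. window_ent j) = (\<Sum>j<K - 1. window_ent j) + window_ent (K - 1)"
    by (subst K(2)) simp
  moreover have "(real K * real N - 1) * real F =
      real (K - 1) * (real N * real F) + (real N - 1) * real F"
    using two_files N_le by (simp add: of_nat_diff algebra_simps)
  moreover have "K - 1 < K" "Suc (K - 1) = K" using K by auto
  ultimately show ?thesis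
    using ent_chain[of "K - 1"] unfolding K(1) window_ent_def by simp
qed

lemma tradeoff: "real K * real N - 1 \<le> real K * (M + (real N - 1) * R)"
proof -
  have "(\<Sum>j<K. window_ent j) \<le> real K * ((M + (real N - 1) * R) * real F)"
  proof (rule sum_le_of_folded_pairs[of "N - 1"])
    show "N - 1 < K" "K \<le> 2 * (N - 1) + 1" using two_files N_le K_less by auto
  qed (use window_ent_le window_ent_pair_le in auto)
  then have "(real K * real N - 1) * real F \<le> (real K * (M + (real N - 1) * R)) * real F"
    using sum_window_ent_ge by (simp add: mult.assoc)
  then show ?thesis using F_pos by simp
qed

end

theorem theorem2:
  fixes N K :: nat and M R :: real
  assumes "0 < N" and "0 < K"
    and "\<lceil>(real K + 1) / 2\<rceil> \<le> int N" and "N \<le> K"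
    and "achievable N K M R"
  shows "real K * M + real K * (real N - 1) * R \<ge> real K * real N - 1"
proof -
  have "(real K + 1) / 2 \<le> real N" using assms(3) by (simp add: ceiling_le_iff)
  then have K: "K < 2 * N" by simp
  obtain F Z X where ach: "0 \<le> M" "0 \<le> R" "caching_scheme N K M R F Z X" "symmetric_scheme N K F Z X"
    using assms(5) unfolding achievable_def by blast
  show ?thesis
  proof (cases "N = 1")
    case True
    \<comment> \<open>With one file and one user the claim reduces to
      \<open>M \<ge> 0\<close>.\<close>
    then have "K = 1" using K assms(4) by simp
    then show ?thesis using True ach by simp
  next
    case False
    then interpret folded_caching N K F M R Z X
      using assms(1,4) K ach by unfold_locales auto
    show ?thesis using tradeoff by (simp add: algebra_simps)
  qed
qed

end
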